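(* Let $\mathbf a_0,\mathbf a_1$ be complex random variables such that the real random vector $(\Re[\mathbf a_0],\Im[\mathbf a_0],\Re[\mathbf a_1],\Im[\mathbf a_1])\in\mathbb R^4$ is spherically distributed and has a density with respect to Lebesgue measure. Then the condensed density $h_2$ for $n=2$ is the uniform measure on the Riemann sphere: $$h_2(z)=\frac{1}{\pi(1+|z|^2)^2},\qquad z\in\mathbb C.$$
   Context: A random vector in $\mathbb R^m$ is spherically distributed if its law is invariant under all orthogonal transformations of $\mathbb R^m$. For even $n$ and complex random variables $\mathbf a_0,\dots,\mathbf a_{n-1}$, put $p=n/2$ and let $U(\mathbf a_0,\dots,\mathbf a_{n-2})$ denote the $p\times p$ Hankel matrix with $(i,j)$ entry $\mathbf a_{i+j-2}$, and $U(\mathbf a_1,\dots,\mathbf a_{n-1})$ the one with $(i,j)$ entry $\mathbf a_{i+j-1}$. Let $\boldsymbol\zeta_1,\dots,\boldsymbol\zeta_{n/2}$ (the "Padé poles") be the generalized eigenvalues of the pencil, i.e. the roots in $z$ of $\det[U(\mathbf a_1,\dots,\mathbf a_{n-1})-zU(\mathbf a_0,\dots,\mathbf a_{n-2})]$. For $n=2$ there is a single one, $\boldsymbol\zeta_1=\mathbf a_1/\mathbf a_0$. The condensed density is $h_n(z)=\frac{2}{n}E\big[\sum_{j=1}^{n/2}\delta(z-\boldsymbol\zeta_j)\big]$, i.e. $\int_B h_n(z)\,dz=\frac2nE[\#\{j:\boldsymbol\zeta_j\in B\}]$ for every Borel set $B\subset\mathbb C$, where $dz$ is two-dimensional Lebesgue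 measure. For $n=2$, $h_2$ is thus the probability density of $\mathbf a_1/\mathbf a_0$ on $\mathbb C$. *)

theory Defs
  imports
    "HOL-Probability.Probability"
    "HOL-Computational_Algebra.Computational_Algebra"
    "Jordan_Normal_Form.Determinant"
begin

definition spherically_distributed :: "'w measure \<Rightarrow> ('w \<Rightarrow> real ^ 'm) \<Rightarrow> bool" where
  "spherically_distributed M X \<longleftrightarrow>
     X \<in> borel_measurable M \<and>
     (\<forall>T. orthogonal_transformation T \<longrightarrow> distr M borel (\<lambda>\<omega>. T (X \<omega>)) = distr M borel X)"

text \<open>
  The \<open>p \<times> p\<close> Hankel matrix \<open>U(a\<^sub>s, \<dots>, a\<^bsub>s+2p-2\<^esub>)\<close>. Indices start at 0, so that the usual
  entries \<open>a\<^bsub>i+j-2\<^esub>\<close> and \<open>a\<^bsub>i+j-1\<^esub>\<close> with \<open>1 \<le> i, j \<le> p\<close> correspond to \<open>s = 0\<close> and \<open>s = 1\<close>.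
\<close>

definition hankel_mat :: "nat \<Rightarrow> nat \<Rightarrow> (nat \<Rightarrow> complex) \<Rightarrow> complex mat" where
  "hankel_mat p s a = Matrix.mat p p (\<lambda>(i, j). a (i + j + s))"

text \<open>
  \<open>det [U(a\<^sub>1, \<dots>, a\<^bsub>n-1\<^esub>) - z U(a\<^sub>0, \<dots>, a\<^bsub>n-2\<^esub>)]\<close> as a polynomial in \<open>z\<close>, for even \<open>n\<close>.
\<close>

definition pade_poly :: "nat \<Rightarrow> (nat \<Rightarrow> complex) \<Rightarrow> complex poly" where
  "pade_poly n a =
     Determinant.det (map_mat (\<lambda>c. [:c:]) (hankel_mat (n div 2) 1 a)
          - [:0, 1:] \<cdot>\<^sub>m map_mat (\<lambda>c. [:c:]) (hankel_mat (n div 2) 0 a))"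

text \<open>
  The roots are counted with multiplicity. There are exactly \<open>n div 2\<close> of them iff
  \<open>U(a\<^sub>0, \<dots>, a\<^bsub>n-2\<^esub>)\<close> is nonsingular, and none if the polynomial vanishes identically.
\<close>

definition pade_poles :: "nat \<Rightarrow> (nat \<Rightarrow> complex) \<Rightarrow> complex multiset" where
  "pade_poles n a = proots (pade_poly n a)"

lemma poly_pade_poly:
  "poly (pade_poly n a) z =
     Determinant.det (hankel_mat (n div 2) 1 a - z \<cdot>\<^sub>m hankel_mat (n div 2) 0 a)"
proof -
  interpret ev: comm_ring_hom "\<lambda>q. poly q z"
    by unfold_locales auto
  have "map_mat (\<lambda>q. poly q z) (map_mat (\<lambda>c. [:c:]) (hankel_mat (n div 2) 1 a)
          - [:0, 1:] \<cdot>\<^sub>m map_mat (\<lambda>c. [:c:]) (hankel_mat (n div 2) 0 a))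
        = hankel_mat (n div 2) 1 a - z \<cdot>\<^sub>m hankel_mat (n div 2) 0 a"
    by (intro eq_matI) (auto simp: hankel_mat_def)
  then show ?thesis
    unfolding pade_poly_def by (metis ev.hom_det)
qed

lemma pade_poly_2: "pade_poly 2 a = [:a 1, - a 0:]"
proof -
  let ?A = "map_mat (\<lambda>c. [:c:]) (hankel_mat 1 1 a)
          - [:0, 1:] \<cdot>\<^sub>m map_mat (\<lambda>c. [:c:]) (hankel_mat 1 0 a)"
  have "?A \<in> carrier_mat 1 1"
    by (intro carrier_matI) (simp_all add: hankel_mat_def)
  then have "Determinant.det ?A = ?A $$ (0, 0)"
    by (rule det_single)
  then show ?thesis
    by (simp add: pade_poly_def hankel_mat_def)
qed

lemma pade_poles_2:
  assumes "a 0 \<noteq> 0"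
  shows "pade_poles 2 a = {#a 1 / a 0#}"
proof -
  have "pade_poly 2 a = Polynomial.smult (- a 0) [:- (a 1 / a 0), 1:]"
    using assms by (simp add: pade_poly_2)
  then show ?thesis
    using assms by (simp add: pade_poles_def del: smult_pCons)
qed

text \<open>
  \<open>lborel\<close> on \<^typ>\<open>complex\<close> is two-dimensional Lebesgue measure. Both sides are extended
  nonnegative integrals, the right-hand one being the expected number of poles in \<open>B\<close>.
  As a density, \<open>h\<close> is determined only up to null sets.
\<close>

definition is_condensed_density ::
  "'w measure \<Rightarrow> nat \<Rightarrow> (nat \<Rightarrow> 'w \<Rightarrow> complex) \<Rightarrow> (complex \<Rightarrow> real) \<Rightarrow> bool" where
  "is_condensed_density M n a h \<longleftrightarrow>
     h \<in> borel_measurable borel \<and> (\<forall>z. 0 \<le> h z) \<and>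
     (\<forall>B\<in>sets borel.
        (\<integral>\<^sup>+z\<in>B. ennreal (h z) \<partial>lborel) =
        ennreal (2 / real n) *
        (\<integral>\<^sup>+\<omega>. of_nat (size (filter_mset (\<lambda>\<zeta>. \<zeta> \<in> B) (pade_poles n (\<lambda>k. a k \<omega>)))) \<partial>M))"

end

theory Submission
  imports Defs
begin

text \<open>
  Identify \<open>(a, b) \<in> \<complex>\<^sup>2\<close> with a quaternion. Multiplying it on the right by the quaternion of
  \<open>(u, v)\<close> gives \<open>(a u - cnj b v, b u + cnj a v)\<close>, which for \<open>\<bar>u\<bar>\<^sup>2 + \<bar>v\<bar>\<^sup>2 = 1\<close> is an
  orthogonal map of \<open>\<real>\<^sup>4\<close>. Hence a spherical law of \<open>(a, b)\<close> is invariant under it. A ratio is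
  insensitive to real scalings, so the law of \<open>b / a\<close> equals that of
  \<open>(b u + cnj a v) / (a u - cnj b v)\<close> for every fixed \<open>(u, v) \<noteq> (0, 0)\<close>, of any length.

  Average this identity over \<open>(u, v)\<close> with weight \<open>exp (- \<bar>u\<bar>\<^sup>2 - \<bar>v\<bar>\<^sup>2)\<close> and exchange the
  integrals, so that \<open>(a, b)\<close> is fixed while \<open>(u, v)\<close> varies. In \<open>(u, v)\<close> the map
  is complex linear with determinant \<open>\<bar>a\<bar>\<^sup>2 + \<bar>b\<bar>\<^sup>2\<close>, and it multiplies the Euclidean norm by a
  constant. The substitution turns the inner integral into the Gaussian integral of
  \<open>v / u \<in> B\<close>, up to a dilation, and so into a quantity that no longer depends on
  \<open>(a, b)\<close> (\<open>nn_integral_gaussian_ratio\<close>). Whatever the radial part of the law, the ratio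
  is thus distributed as for a standard Gaussian vector. Putting \<open>v = u z\<close>, whose Jacobian is
  \<open>\<bar>u\<bar>\<^sup>2\<close>, leaves the Gaussian moment
  \<open>\<integral> \<bar>u\<bar>\<^sup>2 exp (- k \<bar>u\<bar>\<^sup>2) du = \<pi> / k\<^sup>2\<close> at \<open>k = 1 + \<bar>z\<bar>\<^sup>2\<close> (times a constant),
  which is the stated density.

  That the law of \<open>(a\<^sub>0, a\<^sub>1)\<close> has a density serves to exclude \<open>a\<^sub>0 = 0\<close>: almost surely there is
  exactly one pole, and it is \<open>a\<^sub>1 / a\<^sub>0\<close>.
\<close>

section \<open>Linear substitutions in Lebesgue integrals\<close>

lemma lborel_complex:
  "(lborel :: complex measure) = distr (lborel \<Otimes>\<^sub>M lborel) borel (\<lambda>(x, y). Complex x y)"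
proof (rule lborel_eqI)
  fix l u :: complex assume lu: "\<And>b. b \<in> Basis \<Longrightarrow> inner l b \<le> inner u b"
  have le: "Re l \<le> Re u" "Im l \<le> Im u"
    using lu[of 1] lu[of \<i>] by (auto simp: Basis_complex_def)
  have m: "(\<lambda>(x, y). Complex x y) \<in> lborel \<Otimes>\<^sub>M lborel \<rightarrow>\<^sub>M borel"
    by (simp add: case_prod_beta' complex_eq_iff Complex_eq)
  have "(\<lambda>(x, y). Complex x y) -` box l u \<inter> space (lborel \<Otimes>\<^sub>M lborel)
      = {Re l <..< Re u} \<times> {Im l <..< Im u}"
    by (auto simp: in_box_complex_iff space_pair_measure)
  then show "emeasure (distr (lborel \<Otimes>\<^sub>M lborel) borel (\<lambda>(x, y). Complex x y)) (box l u)
      = ennreal (\<Prod>b\<in>Basis. inner (u - l) b)"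
    using le m by (simp add: emeasure_distr lborel.emeasure_pair_measure_Times
        Basis_complex_def ennreal_mult)
qed simp

lemma nn_integral_complex_iterated:
  fixes f :: "complex \<Rightarrow> ennreal"
  assumes [measurable]: "f \<in> borel_measurable borel"
  shows "(\<integral>\<^sup>+z. f z \<partial>lborel) = (\<integral>\<^sup>+x. \<integral>\<^sup>+y. f (Complex x y) \<partial>lborel \<partial>lborel)"
proof -
  have [measurable]: "(\<lambda>p. Complex (fst p) (snd p)) \<in> lborel \<Otimes>\<^sub>M lborel \<rightarrow>\<^sub>M borel"
    by (simp add: Complex_eq)
  show ?thesis
    by (subst lborel_complex)
       (simp add: case_prod_beta' nn_integral_distr lborel.nn_integral_fst[symmetric])
qed

lemma nn_integral_lborel_translate:
  fixes f :: "'a::euclidean_space \<Rightarrow> ennreal"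
  assumes [measurable]: "f \<in> borel_measurable borel"
  shows "(\<integral>\<^sup>+x. f (t + x) \<partial>lborel) = (\<integral>\<^sup>+x. f x \<partial>lborel)"
proof -
  have "(\<integral>\<^sup>+x. f x \<partial>distr lborel borel ((+) t)) = (\<integral>\<^sup>+x. f (t + x) \<partial>lborel)"
    by (rule nn_integral_distr) auto
  then show ?thesis
    by (simp add: lborel_distr_plus)
qed

text \<open>
  Over the field \<open>'k\<close>, an invertible \<open>2 \<times> 2\<close> matrix with \<open>a \<noteq> 0\<close> is a product of two triangular
  matrices, so Fubini reduces the substitution to affine substitutions in one variable. How
  \<open>lborel\<close> scales in one variable is a hypothesis, because the lemma is used twice: over the reals
  (\<open>m = 1\<close>) it yields the scaling over the complex numbers, and with the latter (\<open>m = 2\<close>) it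
  yields complex linear maps of \<open>\<complex>\<^sup>2\<close>.
\<close>

lemma nn_integral_linear_2:
  fixes F :: "'k::{real_normed_field, euclidean_space} \<times> 'k \<Rightarrow> ennreal" and a b c d :: 'k
  assumes scale: "\<And>k (f :: 'k \<Rightarrow> ennreal). k \<noteq> 0 \<Longrightarrow> f \<in> borel_measurable borel \<Longrightarrow>
      ennreal (norm k ^ m) * (\<integral>\<^sup>+x. f (k * x) \<partial>lborel) = (\<integral>\<^sup>+x. f x \<partial>lborel)"
    and [measurable]: "F \<in> borel_measurable (borel \<Otimes>\<^sub>M borel)"
    and "a \<noteq> 0" and "a * d - b * c \<noteq> 0"
  shows "ennreal (norm (a * d - b * c) ^ m) *
      (\<integral>\<^sup>+x. \<integral>\<^sup>+y. F (a * x + b * y, c * x + d * y) \<partial>lborel \<partial>lborel) =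
      (\<integral>\<^sup>+x. \<integral>\<^sup>+y. F (x, y) \<partial>lborel \<partial>lborel)"
proof -
  define e where "e = (a * d - b * c) / a"
  have "e \<noteq> 0"
    using assms by (simp add: e_def)
  have affine: "ennreal (norm k ^ m) * (\<integral>\<^sup>+x. f (t + k * x) \<partial>lborel) = (\<integral>\<^sup>+x. f x \<partial>lborel)"
    if "k \<noteq> 0" and [measurable]: "f \<in> borel_measurable borel" for k t and f :: "'k \<Rightarrow> ennreal"
    using scale[OF \<open>k \<noteq> 0\<close>, of "\<lambda>x. f (t + x)"] by (simp add: nn_integral_lborel_translate)
  \<comment> \<open>The matrix factors into two triangular ones:
      \<open>x' = a x + b y\<close> at fixed \<open>y\<close>, then \<open>y' = (c / a) x' + e y\<close> at fixed \<open>x'\<close>.\<close>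
  have "ennreal (norm a ^ m) *
        (\<integral>\<^sup>+x. \<integral>\<^sup>+y. F (a * x + b * y, c * x + d * y) \<partial>lborel \<partial>lborel)
      = ennreal (norm a ^ m) *
        (\<integral>\<^sup>+y. \<integral>\<^sup>+x. F (a * x + b * y, c * x + d * y) \<partial>lborel \<partial>lborel)"
    by (subst lborel_pair.Fubini') (auto simp: case_prod_beta')
  also have "\<dots> = (\<integral>\<^sup>+y. ennreal (norm a ^ m) *
        (\<integral>\<^sup>+x. F (a * x + b * y, c * x + d * y) \<partial>lborel) \<partial>lborel)"
    by (rule nn_integral_cmult[symmetric]) measurable
  also have "\<dots> = (\<integral>\<^sup>+y. \<integral>\<^sup>+x. F (x, c / a * x + e * y) \<partial>lborel \<partial>lborel)"
  proof (rule nn_integral_cong)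
    fix y
    have "c / a * (b * y + a * x) + e * y = c * x + d * y" for x
    proof -
      have "a * (c / a * (b * y + a * x) + e * y) = c * (b * y + a * x) + (a * d - b * c) * y"
        using \<open>a \<noteq> 0\<close> by (simp add: e_def distrib_left)
      also have "\<dots> = a * (c * x + d * y)"
        by (simp add: algebra_simps)
      finally show ?thesis
        using \<open>a \<noteq> 0\<close> mult_left_cancel by blast
    qed
    then have eq: "F (b * y + a * x, c / a * (b * y + a * x) + e * y)
        = F (a * x + b * y, c * x + d * y)" for x
      by (simp only: add.commute[of "b * y"])
    have "(\<lambda>x. F (x, c / a * x + e * y)) \<in> borel_measurable borel"
      by measurable
    from affine[OF \<open>a \<noteq> 0\<close> this, of "b * y"]
    show "ennreal (norm a ^ m) * (\<integral>\<^sup>+x. F (a * x + b * y, c * x + d * y) \<partial>lborel)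
        = (\<integral>\<^sup>+x. F (x, c / a * x + e * y) \<partial>lborel)"
      by (simp only: eq)
  qed
  also have "\<dots> = (\<integral>\<^sup>+x. \<integral>\<^sup>+y. F (x, c / a * x + e * y) \<partial>lborel \<partial>lborel)"
    by (subst lborel_pair.Fubini') (auto simp: case_prod_beta')
  finally have 1: "ennreal (norm a ^ m) *
        (\<integral>\<^sup>+x. \<integral>\<^sup>+y. F (a * x + b * y, c * x + d * y) \<partial>lborel \<partial>lborel)
      = (\<integral>\<^sup>+x. \<integral>\<^sup>+y. F (x, c / a * x + e * y) \<partial>lborel \<partial>lborel)" .
  have "norm (a * d - b * c) ^ m = norm e ^ m * norm a ^ m"
    using \<open>a \<noteq> 0\<close> by (simp add: e_def norm_divide power_divide)
  then have "ennreal (norm (a * d - b * c) ^ m) *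
        (\<integral>\<^sup>+x. \<integral>\<^sup>+y. F (a * x + b * y, c * x + d * y) \<partial>lborel \<partial>lborel)
      = ennreal (norm e ^ m) * (\<integral>\<^sup>+x. \<integral>\<^sup>+y. F (x, c / a * x + e * y) \<partial>lborel \<partial>lborel)"
    by (simp add: ennreal_mult mult.assoc 1)
  also have "\<dots> = (\<integral>\<^sup>+x. ennreal (norm e ^ m) * (\<integral>\<^sup>+y. F (x, c / a * x + e * y) \<partial>lborel) \<partial>lborel)"
    by (rule nn_integral_cmult[symmetric]) measurable
  also have "\<dots> = (\<integral>\<^sup>+x. \<integral>\<^sup>+y. F (x, y) \<partial>lborel \<partial>lborel)"
    by (intro nn_integral_cong affine[OF \<open>e \<noteq> 0\<close>]) measurable
  finally show ?thesis .
qed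

lemma nn_integral_real_scale:
  fixes f :: "real \<Rightarrow> ennreal"
  assumes "k \<noteq> 0" and "f \<in> borel_measurable borel"
  shows "ennreal (norm k ^ 1) * (\<integral>\<^sup>+x. f (k * x) \<partial>lborel) = (\<integral>\<^sup>+x. f x \<partial>lborel)"
  using nn_integral_real_affine[OF assms(2,1), of 0] by simp

text \<open>
  Multiplication by \<open>c\<close> is the real linear map with matrix entries \<open>Re c, - Im c, Im c, Re c\<close>
  and determinant \<open>\<bar>c\<bar>\<^sup>2\<close>.
\<close>

lemma nn_integral_complex_scale:
  fixes f :: "complex \<Rightarrow> ennreal"
  assumes "c \<noteq> 0" and "f \<in> borel_measurable borel"
  shows "ennreal (norm c ^ 2) * (\<integral>\<^sup>+z. f (c * z) \<partial>lborel) = (\<integral>\<^sup>+z. f z \<partial>lborel)"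
proof -
  have real_part: "ennreal (norm c ^ 2) * (\<integral>\<^sup>+z. f (c * z) \<partial>lborel) = (\<integral>\<^sup>+z. f z \<partial>lborel)"
    if "Re c \<noteq> 0" and [measurable]: "f \<in> borel_measurable borel"
    for c and f :: "complex \<Rightarrow> ennreal"
  proof -
    let ?F = "\<lambda>p. f (Complex (fst p) (snd p))"
    have F: "?F \<in> borel_measurable (borel \<Otimes>\<^sub>M borel)"
      by (simp add: Complex_eq)
    have det: "Re c * Re c - - Im c * Im c = (norm c)\<^sup>2"
      unfolding cmod_power2 by (simp add: power2_eq_square)
    have "c \<noteq> 0"
      using \<open>Re c \<noteq> 0\<close> by auto
    then have det_nonzero: "Re c * Re c - - Im c * Im c \<noteq> 0"
      unfolding det by simp
    have mult: "Complex (Re c * x + - Im c * y) (Im c * x + Re c * y) = c * Complex x y" for x y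
      by (simp add: complex_eq_iff)
    have "ennreal (norm c ^ 2) * (\<integral>\<^sup>+x. \<integral>\<^sup>+y. f (c * Complex x y) \<partial>lborel \<partial>lborel)
        = (\<integral>\<^sup>+x. \<integral>\<^sup>+y. f (Complex x y) \<partial>lborel \<partial>lborel)"
      using nn_integral_linear_2[OF nn_integral_real_scale F \<open>Re c \<noteq> 0\<close> det_nonzero]
      by (simp only: fst_conv snd_conv mult det power_one_right real_norm_def abs_power2 simp_thms)
    then show ?thesis
      by (subst (1 2) nn_integral_complex_iterated) measurable
  qed
  show ?thesis
  proof (cases "Re c = 0")
    case False
    then show ?thesis
      using assms by (intro real_part)
  next
    case True
    \<comment> \<open>Then \<open>c\<close> is the product of \<open>1 + \<i>\<close> and \<open>c / (1 + \<i>)\<close>, neither of which is imaginary.\<close>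
    define e where "e = c / Complex 1 1"
    have ce: "c = Complex 1 1 * e"
      by (simp add: e_def complex_eq_iff[of _ 0])
    have "e = c * Complex (1 / 2) (- 1 / 2)"
      by (simp add: e_def complex_eq_iff Re_divide Im_divide power2_eq_square)
    then have "Re e \<noteq> 0"
      using True \<open>c \<noteq> 0\<close> by (auto simp: complex_eq_iff)
    have "ennreal (norm c ^ 2) * (\<integral>\<^sup>+z. f (c * z) \<partial>lborel)
        = ennreal ((norm (Complex 1 1))\<^sup>2) *
          (ennreal ((norm e)\<^sup>2) * (\<integral>\<^sup>+z. f (Complex 1 1 * (e * z)) \<partial>lborel))"
      unfolding ce norm_mult power_mult_distrib mult.assoc
      by (simp only: ennreal_mult zero_le_power2 mult.assoc)
    also have "ennreal ((norm e)\<^sup>2) * (\<integral>\<^sup>+z. f (Complex 1 1 * (e * z)) \<partial>lborel)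
        = (\<integral>\<^sup>+z. f (Complex 1 1 * z) \<partial>lborel)"
      by (rule real_part[OF \<open>Re e \<noteq> 0\<close>]) (use assms(2) in measurable)
    also have "ennreal ((norm (Complex 1 1))\<^sup>2) * \<dots> = (\<integral>\<^sup>+z. f z \<partial>lborel)"
      by (rule real_part) (simp, fact assms(2))
    finally show ?thesis .
  qed
qed

section \<open>Gaussian integrals over the complex plane\<close>

lemma nn_integral_gaussian:
  "(\<integral>\<^sup>+(x::real). ennreal (exp (- x\<^sup>2)) \<partial>lborel) = ennreal (sqrt pi)"
  "(\<integral>\<^sup>+(x::real). ennreal (x\<^sup>2 * exp (- x\<^sup>2)) \<partial>lborel) = ennreal (sqrt pi / 2)"
proof -
  have "has_bochner_integral lborel (\<lambda>x::real. exp (- x\<^sup>2)) (2 * (sqrt pi / 2))"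
    using has_bochner_integral_even_function[OF gaussian_moment_0] by simp
  then show "(\<integral>\<^sup>+(x::real). ennreal (exp (- x\<^sup>2)) \<partial>lborel) = ennreal (sqrt pi)"
    by (simp add: has_bochner_integral_iff nn_integral_eq_integral)
  have "has_bochner_integral lborel (\<lambda>x::real. x\<^sup>2 * exp (- x\<^sup>2)) (sqrt pi / 2)"
    using has_bochner_integral_even_function[OF gaussian_moment_even_pos[where k = 1]]
    by (simp add: mult.commute fact_numeral)
  then show "(\<integral>\<^sup>+(x::real). ennreal (x\<^sup>2 * exp (- x\<^sup>2)) \<partial>lborel) = ennreal (sqrt pi / 2)"
    by (simp add: has_bochner_integral_iff nn_integral_eq_integral)
qed

lemma nn_integral_complex_gaussian:
  "(\<integral>\<^sup>+z. ennreal (exp (- (cmod z)\<^sup>2)) \<partial>lborel) = ennreal pi"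
  "(\<integral>\<^sup>+z. ennreal ((cmod z)\<^sup>2 * exp (- (cmod z)\<^sup>2)) \<partial>lborel) = ennreal pi"
proof -
  have 1: "exp (- (cmod (Complex x y))\<^sup>2) = exp (- x\<^sup>2) * exp (- y\<^sup>2)" for x y
    by (simp add: cmod_power2 exp_add[symmetric])
  have 2: "(cmod (Complex x y))\<^sup>2 * exp (- (cmod (Complex x y))\<^sup>2)
      = x\<^sup>2 * exp (- x\<^sup>2) * exp (- y\<^sup>2) + exp (- x\<^sup>2) * (y\<^sup>2 * exp (- y\<^sup>2))" for x y
    unfolding 1 by (simp add: cmod_power2 algebra_simps)
  have "(\<integral>\<^sup>+z. ennreal (exp (- (cmod z)\<^sup>2)) \<partial>lborel)
      = (\<integral>\<^sup>+x. \<integral>\<^sup>+y. ennreal (exp (- x\<^sup>2)) * ennreal (exp (- y\<^sup>2)) \<partial>lborel \<partial>lborel)"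
    by (subst nn_integral_complex_iterated) (simp_all only: 1 ennreal_mult exp_ge_zero, measurable)
  also have "\<dots> = ennreal (sqrt pi) * ennreal (sqrt pi)"
    by (simp add: nn_integral_cmult nn_integral_multc nn_integral_gaussian)
  finally show "(\<integral>\<^sup>+z. ennreal (exp (- (cmod z)\<^sup>2)) \<partial>lborel) = ennreal pi"
    by (simp flip: ennreal_mult)
  have "(\<integral>\<^sup>+z. ennreal ((cmod z)\<^sup>2 * exp (- (cmod z)\<^sup>2)) \<partial>lborel)
      = (\<integral>\<^sup>+x. \<integral>\<^sup>+y. ennreal (x\<^sup>2 * exp (- x\<^sup>2)) * ennreal (exp (- y\<^sup>2)) +
          ennreal (exp (- x\<^sup>2)) * ennreal (y\<^sup>2 * exp (- y\<^sup>2)) \<partial>lborel \<partial>lborel)"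
    by (subst nn_integral_complex_iterated)
       (simp_all only: 2 ennreal_mult ennreal_plus exp_ge_zero zero_le_power2 mult_nonneg_nonneg, measurable)
  also have "\<dots> = ennreal (sqrt pi / 2) * ennreal (sqrt pi) + ennreal (sqrt pi) * ennreal (sqrt pi / 2)"
    by (simp add: nn_integral_add nn_integral_cmult nn_integral_multc nn_integral_gaussian)
  also have "ennreal (sqrt pi / 2) * ennreal (sqrt pi) = ennreal (pi / 2)"
    by (simp flip: ennreal_mult)
  also have "ennreal (sqrt pi) * ennreal (sqrt pi / 2) = ennreal (pi / 2)"
    by (simp flip: ennreal_mult)
  also have "ennreal (pi / 2) + ennreal (pi / 2) = ennreal pi"
    by (simp flip: ennreal_plus)
  finally show "(\<integral>\<^sup>+z. ennreal ((cmod z)\<^sup>2 * exp (- (cmod z)\<^sup>2)) \<partial>lborel) = ennreal pi" .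
qed

lemma nn_integral_complex_gaussian_moment:
  fixes k :: real
  assumes "k > 0"
  shows "(\<integral>\<^sup>+z. ennreal ((cmod z)\<^sup>2 * exp (- (k * (cmod z)\<^sup>2))) \<partial>lborel) = ennreal (pi / k\<^sup>2)"
proof -
  define c where "c = complex_of_real (sqrt k)"
  have c: "c \<noteq> 0" "(cmod c)\<^sup>2 = k"
    using assms by (auto simp: c_def)
  have "ennreal ((cmod c)\<^sup>2) * (\<integral>\<^sup>+z. ennreal ((cmod (c * z))\<^sup>2 * exp (- (cmod (c * z))\<^sup>2)) \<partial>lborel)
      = ennreal pi"
    by (subst nn_integral_complex_scale[OF c(1)]) (simp_all add: nn_integral_complex_gaussian)
  also have "(\<integral>\<^sup>+z. ennreal ((cmod (c * z))\<^sup>2 * exp (- (cmod (c * z))\<^sup>2)) \<partial>lborel)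
      = (\<integral>\<^sup>+z. ennreal k * ennreal ((cmod z)\<^sup>2 * exp (- (k * (cmod z)\<^sup>2))) \<partial>lborel)"
    using assms by (simp add: norm_mult power_mult_distrib c ennreal_mult[symmetric] mult.assoc)
  also have "\<dots> = ennreal k * (\<integral>\<^sup>+z. ennreal ((cmod z)\<^sup>2 * exp (- (k * (cmod z)\<^sup>2))) \<partial>lborel)"
    by (rule nn_integral_cmult) measurable
  finally have "ennreal (k\<^sup>2) * (\<integral>\<^sup>+z. ennreal ((cmod z)\<^sup>2 * exp (- (k * (cmod z)\<^sup>2))) \<partial>lborel)
      = ennreal pi"
    using assms c by (simp add: mult.assoc[symmetric] ennreal_mult[symmetric] power2_eq_square)
  also have "ennreal pi = ennreal (k\<^sup>2) * ennreal (pi / k\<^sup>2)"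
    using assms by (simp flip: ennreal_mult)
  finally show ?thesis
    using assms by (simp add: ennreal_mult_cancel_left)
qed

lemma nn_integral_complex_gaussian_pair:
  "(\<integral>\<^sup>+u. \<integral>\<^sup>+v. ennreal (exp (- ((cmod u)\<^sup>2 + (cmod v)\<^sup>2))) \<partial>lborel \<partial>lborel) = ennreal (pi\<^sup>2)"
proof -
  have "exp (- ((cmod u)\<^sup>2 + (cmod v)\<^sup>2)) = exp (- (cmod u)\<^sup>2) * exp (- (cmod v)\<^sup>2)" for u v
    by (simp flip: exp_add)
  then show ?thesis
    by (simp only: ennreal_mult exp_ge_zero)
       (simp add: nn_integral_cmult nn_integral_multc nn_integral_complex_gaussian
          power2_eq_square[of pi] ennreal_mult)
qed

section \<open>The ratio of two Gaussian coordinates\<close>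

text \<open>
  For fixed \<open>(a, b)\<close> the linear substitution makes the event read \<open>v / u \<in> B\<close> and merely dilates
  the Gaussian weight by a factor that depends on \<open>\<bar>a\<bar>\<^sup>2 + \<bar>b\<bar>\<^sup>2\<close>. As the event does not change under
  dilations, the result is the same for all \<open>a\<close> and \<open>b\<close>: this is what makes the radial part of
  the law of \<open>(a, b)\<close> irrelevant.
\<close>

lemma nn_integral_gaussian_ratio:
  fixes a b :: complex
  assumes "a \<noteq> 0" and [measurable]: "B \<in> sets borel"
  shows "(\<integral>\<^sup>+u. \<integral>\<^sup>+v. ennreal (exp (- ((cmod u)\<^sup>2 + (cmod v)\<^sup>2))) *
        indicator B ((b * u + cnj a * v) / (a * u - cnj b * v)) \<partial>lborel \<partial>lborel)
      = ennreal (pi\<^sup>2) * (\<integral>\<^sup>+z\<in>B. ennreal (1 / (pi * (1 + (cmod z)\<^sup>2)\<^sup>2)) \<partial>lborel)"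
    (is "?lhs = _")
proof -
  define r where "r = (cmod a)\<^sup>2 + (cmod b)\<^sup>2"
  have "r > 0"
    using \<open>a \<noteq> 0\<close> by (simp add: r_def add_pos_nonneg)
  define F :: "complex \<times> complex \<Rightarrow> ennreal" where
    "F = (\<lambda>p. ennreal (exp (- (((cmod (fst p))\<^sup>2 + (cmod (snd p))\<^sup>2) / r))) * indicator B (snd p / fst p))"
  have F [measurable]: "F \<in> borel_measurable (borel \<Otimes>\<^sub>M borel)"
    unfolding F_def by measurable
  have det: "a * cnj a - - cnj b * b = complex_of_real r"
    by (simp add: r_def complex_norm_square[symmetric] mult.commute[of "cnj b"])
  have det_nonzero: "a * cnj a - - cnj b * b \<noteq> 0"
    unfolding det using \<open>r > 0\<close> by simp
  have norm: "((cmod (a * u + - cnj b * v))\<^sup>2 + (cmod (b * u + cnj a * v))\<^sup>2) / r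
      = (cmod u)\<^sup>2 + (cmod v)\<^sup>2" for u v
  proof -
    have "(cmod (a * u + - cnj b * v))\<^sup>2 + (cmod (b * u + cnj a * v))\<^sup>2
        = r * ((cmod u)\<^sup>2 + (cmod v)\<^sup>2)"
      unfolding r_def cmod_power2 by (simp add: power2_eq_square algebra_simps)
    then show ?thesis
      using \<open>r > 0\<close> by simp
  qed
  \<comment> \<open>Substitute \<open>(a u - cnj b v, b u + cnj a v)\<close> for \<open>(u, v)\<close>; the complex determinant is \<open>r\<close>,
      so the real Jacobian is \<open>r\<^sup>2\<close>.\<close>
  have "ennreal (cmod (a * cnj a - - cnj b * b) ^ 2) *
      (\<integral>\<^sup>+u. \<integral>\<^sup>+v. F (a * u + - cnj b * v, b * u + cnj a * v) \<partial>lborel \<partial>lborel)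
      = (\<integral>\<^sup>+u. \<integral>\<^sup>+v. F (u, v) \<partial>lborel \<partial>lborel)"
    by (rule nn_integral_linear_2[OF nn_integral_complex_scale F \<open>a \<noteq> 0\<close> det_nonzero])
  moreover have "(\<lambda>u v. F (a * u + - cnj b * v, b * u + cnj a * v)) =
      (\<lambda>u v. ennreal (exp (- ((cmod u)\<^sup>2 + (cmod v)\<^sup>2))) *
        indicator B ((b * u + cnj a * v) / (a * u - cnj b * v)))"
    unfolding F_def fst_conv snd_conv norm by simp
  ultimately have "ennreal (r\<^sup>2) * ?lhs = (\<integral>\<^sup>+u. \<integral>\<^sup>+v. F (u, v) \<partial>lborel \<partial>lborel)"
    unfolding det norm_of_real power2_abs by metis
  \<comment> \<open>Substitute \<open>v = u z\<close> at fixed \<open>u \<noteq> 0\<close>.\<close>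
  also have "\<dots> = (\<integral>\<^sup>+u. \<integral>\<^sup>+z. ennreal ((cmod u)\<^sup>2 * exp (- ((1 + (cmod z)\<^sup>2) / r * (cmod u)\<^sup>2))) *
      indicator B z \<partial>lborel \<partial>lborel)"
  proof (rule nn_integral_cong_AE)
    have "(\<integral>\<^sup>+v. F (u, v) \<partial>lborel) = (\<integral>\<^sup>+z. ennreal ((cmod u)\<^sup>2 * exp (- ((1 + (cmod z)\<^sup>2) / r * (cmod u)\<^sup>2))) *
        indicator B z \<partial>lborel)" if "u \<noteq> 0" for u
    proof -
      have "(\<integral>\<^sup>+v. F (u, v) \<partial>lborel) = ennreal ((cmod u)\<^sup>2) * (\<integral>\<^sup>+z. F (u, u * z) \<partial>lborel)"
        by (rule nn_integral_complex_scale[OF \<open>u \<noteq> 0\<close>, symmetric]) measurable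
      also have "\<dots> = (\<integral>\<^sup>+z. ennreal ((cmod u)\<^sup>2) * F (u, u * z) \<partial>lborel)"
        by (rule nn_integral_cmult[symmetric]) measurable
      also have "(\<lambda>z. ennreal ((cmod u)\<^sup>2) * F (u, u * z))
          = (\<lambda>z. ennreal ((cmod u)\<^sup>2 * exp (- ((1 + (cmod z)\<^sup>2) / r * (cmod u)\<^sup>2))) * indicator B z)"
      proof
        fix z
        have "((cmod u)\<^sup>2 + (cmod (u * z))\<^sup>2) / r = (1 + (cmod z)\<^sup>2) / r * (cmod u)\<^sup>2"
          by (simp add: norm_mult power_mult_distrib ring_distribs mult.commute)
        then show "ennreal ((cmod u)\<^sup>2) * F (u, u * z)
            = ennreal ((cmod u)\<^sup>2 * exp (- ((1 + (cmod z)\<^sup>2) / r * (cmod u)\<^sup>2))) * indicator B z"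
          using that by (simp only: F_def fst_conv snd_conv nonzero_mult_div_cancel_left
              ennreal_mult zero_le_power2 exp_ge_zero mult.assoc simp_thms)
      qed
      finally show ?thesis .
    qed
    then show "AE u in lborel. (\<integral>\<^sup>+v. F (u, v) \<partial>lborel) = (\<integral>\<^sup>+z. ennreal ((cmod u)\<^sup>2 *
        exp (- ((1 + (cmod z)\<^sup>2) / r * (cmod u)\<^sup>2))) * indicator B z \<partial>lborel)"
      using AE_lborel_singleton[of "0::complex"] by auto
  qed
  also have "\<dots> = (\<integral>\<^sup>+z. \<integral>\<^sup>+u. ennreal ((cmod u)\<^sup>2 * exp (- ((1 + (cmod z)\<^sup>2) / r * (cmod u)\<^sup>2))) *
      indicator B z \<partial>lborel \<partial>lborel)"
    by (rule lborel_pair.Fubini') measurable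
  also have "\<dots> = (\<integral>\<^sup>+z. ennreal (r\<^sup>2) * (ennreal (pi\<^sup>2) *
      (ennreal (1 / (pi * (1 + (cmod z)\<^sup>2)\<^sup>2)) * indicator B z)) \<partial>lborel)"
  proof (rule nn_integral_cong)
    fix z :: complex
    let ?k = "(1 + (cmod z)\<^sup>2) / r"
    have "1 + (cmod z)\<^sup>2 > 0"
      by (simp add: add_pos_nonneg)
    then have "?k > 0"
      using \<open>r > 0\<close> by simp
    have "pi / ?k\<^sup>2 = r\<^sup>2 * (pi\<^sup>2 * (1 / (pi * (1 + (cmod z)\<^sup>2)\<^sup>2)))"
      using \<open>1 + (cmod z)\<^sup>2 > 0\<close> \<open>r > 0\<close> by (simp add: power_divide power2_eq_square[of pi])
    then have "ennreal (pi / ?k\<^sup>2) =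
        ennreal (r\<^sup>2) * (ennreal (pi\<^sup>2) * ennreal (1 / (pi * (1 + (cmod z)\<^sup>2)\<^sup>2)))"
      by (simp flip: ennreal_mult)
    then show "(\<integral>\<^sup>+u. ennreal ((cmod u)\<^sup>2 * exp (- (?k * (cmod u)\<^sup>2))) * indicator B z \<partial>lborel)
        = ennreal (r\<^sup>2) * (ennreal (pi\<^sup>2) *
            (ennreal (1 / (pi * (1 + (cmod z)\<^sup>2)\<^sup>2)) * indicator B z))"
      using nn_integral_complex_gaussian_moment[OF \<open>?k > 0\<close>]
      by (simp add: nn_integral_multc mult.assoc)
  qed
  also have "\<dots> = ennreal (r\<^sup>2) * (ennreal (pi\<^sup>2) *
      (\<integral>\<^sup>+z\<in>B. ennreal (1 / (pi * (1 + (cmod z)\<^sup>2)\<^sup>2)) \<partial>lborel))"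
    by (simp add: nn_integral_cmult)
  finally show ?thesis
    using \<open>r > 0\<close> by (simp add: ennreal_mult_cancel_left)
qed

section \<open>Averaging over the quaternions\<close>

text \<open>
  The assumed identity is integrated against the Gaussian weight in \<open>(u, v)\<close>. After Fubini the inner
  integral is evaluated for each outcome by \<open>nn_integral_gaussian_ratio\<close>, and
  the common factor \<open>\<pi>\<^sup>2\<close>, the total Gaussian mass, cancels.
\<close>

lemma (in prob_space) ratio_density_if_quaternion_invariant:
  fixes a b :: "'a \<Rightarrow> complex"
  assumes [measurable]: "a \<in> borel_measurable M" "b \<in> borel_measurable M" "B \<in> sets borel"
    and nonzero: "AE \<omega> in M. a \<omega> \<noteq> 0"
    and invar: "\<And>u v. (u, v) \<noteq> (0, 0) \<Longrightarrow>
      (\<integral>\<^sup>+\<omega>. indicator B ((b \<omega> * u + cnj (a \<omega>) * v) / (a \<omega> * u - cnj (b \<omega>) * v)) \<partial>M)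
      = (\<integral>\<^sup>+\<omega>. indicator B (b \<omega> / a \<omega>) \<partial>M)"
  shows "(\<integral>\<^sup>+\<omega>. indicator B (b \<omega> / a \<omega>) \<partial>M)
      = (\<integral>\<^sup>+z\<in>B. ennreal (1 / (pi * (1 + (cmod z)\<^sup>2)\<^sup>2)) \<partial>lborel)"
proof -
  let ?g = "\<lambda>u v. ennreal (exp (- ((cmod u)\<^sup>2 + (cmod v)\<^sup>2)))"
  let ?I = "\<lambda>\<omega> u v. indicator B ((b \<omega> * u + cnj (a \<omega>) * v) / (a \<omega> * u - cnj (b \<omega>) * v)) :: ennreal"
  let ?P = "\<integral>\<^sup>+\<omega>. indicator B (b \<omega> / a \<omega>) \<partial>M"
  have [measurable]: "cnj \<in> borel_measurable borel"
    by (intro borel_measurable_continuous_onI continuous_intros)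
  interpret prod: pair_sigma_finite M "lborel :: complex measure" ..
  have "ennreal (pi\<^sup>2) * ?P = (\<integral>\<^sup>+u. \<integral>\<^sup>+v. ?g u v * ?P \<partial>lborel \<partial>lborel)"
    unfolding nn_integral_complex_gaussian_pair[symmetric] by (simp add: nn_integral_multc)
  also have "\<dots> = (\<integral>\<^sup>+u. \<integral>\<^sup>+v. \<integral>\<^sup>+\<omega>. ?g u v * ?I \<omega> u v \<partial>M \<partial>lborel \<partial>lborel)"
  proof (rule nn_integral_cong_AE)
    show "AE u in lborel. (\<integral>\<^sup>+v. ?g u v * ?P \<partial>lborel)
        = (\<integral>\<^sup>+v. \<integral>\<^sup>+\<omega>. ?g u v * ?I \<omega> u v \<partial>M \<partial>lborel)"
      using AE_lborel_singleton[of "0::complex"]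
    proof eventually_elim
      case (elim u)
      then show ?case
        by (intro nn_integral_cong) (simp add: nn_integral_cmult invar)
    qed
  qed
  also have "\<dots> = (\<integral>\<^sup>+u. \<integral>\<^sup>+\<omega>. \<integral>\<^sup>+v. ?g u v * ?I \<omega> u v \<partial>lborel \<partial>M \<partial>lborel)"
    by (intro nn_integral_cong prod.Fubini') measurable
  also have "\<dots> = (\<integral>\<^sup>+\<omega>. \<integral>\<^sup>+u. \<integral>\<^sup>+v. ?g u v * ?I \<omega> u v \<partial>lborel \<partial>lborel \<partial>M)"
    by (rule prod.Fubini') measurable
  also have "\<dots> = (\<integral>\<^sup>+\<omega>. ennreal (pi\<^sup>2) *
      (\<integral>\<^sup>+z\<in>B. ennreal (1 / (pi * (1 + (cmod z)\<^sup>2)\<^sup>2)) \<partial>lborel) \<partial>M)"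
    using nonzero by (intro nn_integral_cong_AE) (elim eventually_mono, rule nn_integral_gaussian_ratio, auto)
  also have "\<dots> = ennreal (pi\<^sup>2) * (\<integral>\<^sup>+z\<in>B. ennreal (1 / (pi * (1 + (cmod z)\<^sup>2)\<^sup>2)) \<partial>lborel)"
    by (simp add: emeasure_space_1)
  finally show ?thesis
    by (simp add: ennreal_mult_cancel_left)
qed

lemma vector_4 [simp]:
  fixes w x y z :: "'a::zero"
  shows "(vector [w, x, y, z] :: 'a ^ 4) $ 1 = w"
  "(vector [w, x, y, z] :: 'a ^ 4) $ 2 = x"
  "(vector [w, x, y, z] :: 'a ^ 4) $ 3 = y"
  "(vector [w, x, y, z] :: 'a ^ 4) $ 4 = z"
  unfolding vector_def by simp_all

text \<open>
  With \<open>x\<close> read as the quaternion \<open>a + j b\<close>, where \<open>z j = j cnj z\<close> for complex \<open>z\<close> and \<open>j\<^sup>2 = - 1\<close>,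
  this is right multiplication by \<open>u + j v\<close>.
\<close>

definition quaternion_times :: "complex \<Rightarrow> complex \<Rightarrow> real ^ 4 \<Rightarrow> real ^ 4" where
  "quaternion_times u v x =
     (let a = Complex (x $ 1) (x $ 2); b = Complex (x $ 3) (x $ 4);
          a' = a * u - cnj b * v; b' = b * u + cnj a * v
      in vector [Re a', Im a', Re b', Im b'])"

lemma orthogonal_transformation_quaternion_times:
  assumes "(cmod u)\<^sup>2 + (cmod v)\<^sup>2 = 1"
  shows "orthogonal_transformation (quaternion_times u v)"
  unfolding orthogonal_transformation
proof
  show "linear (quaternion_times u v)"
    by (rule linearI) (simp_all add: quaternion_times_def Let_def Finite_Cartesian_Product.vec_eq_iff forall_4 algebra_simps)
  have norm_sq: "(norm y)\<^sup>2 = (y $ 1)\<^sup>2 + (y $ 2)\<^sup>2 + (y $ 3)\<^sup>2 + (y $ 4)\<^sup>2" for y :: "real ^ 4"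
    unfolding power2_norm_eq_inner inner_vec_def sum_4 by (simp add: power2_eq_square)
  have "(norm (quaternion_times u v x))\<^sup>2 = ((cmod u)\<^sup>2 + (cmod v)\<^sup>2) * (norm x)\<^sup>2" for x
    unfolding norm_sq cmod_power2
    by (simp add: quaternion_times_def Let_def power2_eq_square algebra_simps)
  then show "\<forall>x. norm (quaternion_times u v x) = norm x"
    using assms by simp
qed

lemma AE_vec_nth_lborel_nonzero: "AE x in lborel. (x :: real ^ 'n) $ i \<noteq> 0"
proof -
  have "negligible {x :: real ^ 'n. x $ i = 0}"
    by (rule negligible_standard_hyperplane_cart)
  then have "AE x in lebesgue. (x :: real ^ 'n) $ i \<noteq> 0"
    by (auto simp: negligible_iff_null_sets intro: AE_I')
  then show ?thesis
    by (simp add: AE_completion_iff)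
qed

lemma size_filter_pade_poles_2:
  assumes "a 0 \<noteq> 0"
  shows "of_nat (size (filter_mset (\<lambda>\<zeta>. \<zeta> \<in> B) (pade_poles 2 a)))
    = (indicator B (a 1 / a 0) :: ennreal)"
  using assms by (simp add: pade_poles_2)

section \<open>The condensed density\<close>

lemma is_condensed_density_AE_unique:
  assumes h: "is_condensed_density M n a h" and k: "is_condensed_density M n a k"
  shows "AE z in lborel. h z = k z"
proof -
  have [measurable]: "h \<in> borel_measurable borel" "k \<in> borel_measurable borel"
    using h k by (auto simp: is_condensed_density_def)
  have "density lborel (\<lambda>z. ennreal (h z)) = density lborel (\<lambda>z. ennreal (k z))"
    using h k by (intro measure_eqI) (auto simp: is_condensed_density_def emeasure_density)
  then have "AE z in lborel. ennreal (h z) = ennreal (k z)"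
    by (intro sigma_finite_measure.density_unique[OF sigma_finite_lborel]) auto
  then show ?thesis
    using h k by (auto simp: is_condensed_density_def)
qed

theorem theorem2:
  fixes M :: "'w measure" and a :: "nat \<Rightarrow> 'w \<Rightarrow> complex"
    and f :: "real ^ 4 \<Rightarrow> ennreal"
  defines "X \<equiv> (\<lambda>\<omega>. vector [Re (a 0 \<omega>), Im (a 0 \<omega>), Re (a 1 \<omega>), Im (a 1 \<omega>)] :: real ^ 4)"
  assumes "prob_space M"
    and "a 0 \<in> borel_measurable M" and "a 1 \<in> borel_measurable M"
    and "spherically_distributed M X"
    and "distributed M lborel X f"
  shows "is_condensed_density M 2 a (\<lambda>z. 1 / (pi * (1 + (cmod z)\<^sup>2)\<^sup>2)) \<and>
         (\<forall>h. is_condensed_density M 2 a h \<longrightarrow>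
            (AE z in lborel. h z = 1 / (pi * (1 + (cmod z)\<^sup>2)\<^sup>2)))"
proof -
  interpret prob_space M by fact
  note [measurable] = assms(3,4)
  have X [measurable]: "X \<in> borel_measurable M"
    and invar: "\<And>T. orthogonal_transformation T \<Longrightarrow>
      distr M borel (\<lambda>\<omega>. T (X \<omega>)) = distr M borel X"
    using assms(5) by (auto simp: spherically_distributed_def)
  define q :: "real ^ 4 \<Rightarrow> complex" where "q x = Complex (x $ 3) (x $ 4) / Complex (x $ 1) (x $ 2)" for x
  have q [measurable]: "q \<in> borel_measurable borel"
    unfolding q_def Complex_eq by measurable
  have qX: "q (X \<omega>) = a 1 \<omega> / a 0 \<omega>" for \<omega>
    by (simp add: q_def X_def)

  have "distr M lborel X = density lborel f" and [measurable]: "f \<in> borel_measurable lborel"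
    using assms(6) by (auto simp: distributed_def)
  moreover have "AE x in density lborel f. x $ 1 \<noteq> 0"
    using AE_vec_nth_lborel_nonzero[of 1] by (subst AE_density) (auto elim: eventually_mono)
  ultimately have "AE x in distr M lborel X. x $ 1 \<noteq> 0"
    by (simp only:)
  then have "AE \<omega> in M. X \<omega> $ 1 \<noteq> 0"
    by (subst (asm) AE_distr_iff) simp_all
  then have nonzero: "AE \<omega> in M. a 0 \<omega> \<noteq> 0"
    by (elim eventually_mono) (auto simp: X_def)

  have rotate: "(\<integral>\<^sup>+\<omega>. indicator B ((a 1 \<omega> * u + cnj (a 0 \<omega>) * v) / (a 0 \<omega> * u - cnj (a 1 \<omega>) * v)) \<partial>M)
      = (\<integral>\<^sup>+\<omega>. indicator B (a 1 \<omega> / a 0 \<omega>) \<partial>M)"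
    if [measurable]: "B \<in> sets borel" and "(u, v) \<noteq> (0, 0)" for B u v
  proof -
    \<comment> \<open>Only unit quaternions act orthogonally; the normalising factor \<open>s\<close> cancels in the ratio.\<close>
    define s where "s = sqrt ((cmod u)\<^sup>2 + (cmod v)\<^sup>2)"
    have "(cmod u)\<^sup>2 + (cmod v)\<^sup>2 > 0"
      using \<open>(u, v) \<noteq> (0, 0)\<close> by (auto simp: sum_power2_gt_zero_iff)
    then have s: "s > 0" "s\<^sup>2 = (cmod u)\<^sup>2 + (cmod v)\<^sup>2"
      by (simp_all add: s_def)
    define T where "T = quaternion_times (u / s) (v / s)"
    have "(cmod (u / s))\<^sup>2 + (cmod (v / s))\<^sup>2 = ((cmod u)\<^sup>2 + (cmod v)\<^sup>2) / s\<^sup>2"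
      by (simp add: norm_divide power_divide add_divide_distrib)
    also have "\<dots> = 1"
      unfolding s(2)[symmetric] using s(1) by simp
    finally have T: "orthogonal_transformation T"
      unfolding T_def by (rule orthogonal_transformation_quaternion_times)
    have [measurable]: "T \<in> borel_measurable borel"
      using T by (intro borel_measurable_continuous_onI linear_continuous_on)
        (simp add: orthogonal_transformation_linear linear_conv_bounded_linear[symmetric])
    have "q (T (X \<omega>)) = (a 1 \<omega> * (u / s) + cnj (a 0 \<omega>) * (v / s)) /
        (a 0 \<omega> * (u / s) - cnj (a 1 \<omega>) * (v / s))" for \<omega>
      unfolding q_def T_def quaternion_times_def X_def Let_def by (simp only: vector_4 complex_surj)
    moreover have "(a 1 \<omega> * (u / s) + cnj (a 0 \<omega>) * (v / s)) /
        (a 0 \<omega> * (u / s) - cnj (a 1 \<omega>) * (v / s)) = ((a 1 \<omega> * u + cnj (a 0 \<omega>) * v) / s) /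
        ((a 0 \<omega> * u - cnj (a 1 \<omega>) * v) / s)" for \<omega>
      by (simp only: times_divide_eq_right add_divide_distrib diff_divide_distrib)
    ultimately have qTX: "q (T (X \<omega>)) = (a 1 \<omega> * u + cnj (a 0 \<omega>) * v) / (a 0 \<omega> * u - cnj (a 1 \<omega>) * v)" for \<omega>
      using s by simp
    have "(\<integral>\<^sup>+\<omega>. indicator B (q (T (X \<omega>))) \<partial>M) = (\<integral>\<^sup>+x. indicator B (q x) \<partial>distr M borel (\<lambda>\<omega>. T (X \<omega>)))"
      by (subst nn_integral_distr) auto
    also have "\<dots> = (\<integral>\<^sup>+\<omega>. indicator B (q (X \<omega>)) \<partial>M)"
      unfolding invar[OF T] by (subst nn_integral_distr) auto
    finally show ?thesis
      unfolding qX qTX .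
  qed
  have "is_condensed_density M 2 a (\<lambda>z. 1 / (pi * (1 + (cmod z)\<^sup>2)\<^sup>2))"
    unfolding is_condensed_density_def
  proof (intro conjI ballI allI)
    fix B :: "complex set" assume B [measurable]: "B \<in> sets borel"
    have "(\<integral>\<^sup>+\<omega>. of_nat (size (filter_mset (\<lambda>\<zeta>. \<zeta> \<in> B) (pade_poles 2 (\<lambda>k. a k \<omega>)))) \<partial>M)
        = (\<integral>\<^sup>+\<omega>. indicator B (a 1 \<omega> / a 0 \<omega>) \<partial>M)"
      using nonzero by (intro nn_integral_cong_AE) (auto simp: size_filter_pade_poles_2)
    also have "\<dots> = (\<integral>\<^sup>+z\<in>B. ennreal (1 / (pi * (1 + (cmod z)\<^sup>2)\<^sup>2)) \<partial>lborel)"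
      by (rule ratio_density_if_quaternion_invariant[OF assms(3,4) B nonzero rotate[OF B]])
    finally show "(\<integral>\<^sup>+z\<in>B. ennreal (1 / (pi * (1 + (cmod z)\<^sup>2)\<^sup>2)) \<partial>lborel)
        = ennreal (2 / real 2) *
          (\<integral>\<^sup>+\<omega>. of_nat (size (filter_mset (\<lambda>\<zeta>. \<zeta> \<in> B) (pade_poles 2 (\<lambda>k. a k \<omega>)))) \<partial>M)"
      by simp
  qed auto
  then show ?thesis
    using is_condensed_density_AE_unique by blast
qed

end
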